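(* For every integer $n \ge 2$, there exists an $(n-1)$-quasi-perfect code in the Cartesian product $P_n \square P_n \square P_3$ and in the Cartesian product $P_n \square P_n \square P_4$.
   Context: All graphs are simple and connected; $d(x,y)$ is the shortest-path distance. $P_n$ is the path on $n$ vertices. The Cartesian product $G\square H$ has vertex set $V(G)\times V(H)$, with $(g_1,h_1)$ adjacent to $(g_2,h_2)$ iff either $h_1=h_2$ and $g_1g_2\in E(G)$, or $g_1=g_2$ and $h_1h_2\in E(H)$. A code is a subset $D$ of the vertex set. $D$ is $t$-error-correcting if any two distinct codewords are at distance at least $2t+1$. The covering radius of $D$ is the smallest $r$ such that every vertex is at distance at most $r$ from some codeword. $D$ is $t$-quasi-perfect if it is $t$-error-correcting with covering radius $t+1$. *)

theory Defs
  imports "Graph_Theory.Graph_Theory"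
begin

text \<open>
  Undirected graphs are symmetric loop-free pair digraphs: an edge \<open>uv\<close> is the pair of arcs
  \<open>(u, v)\<close> and \<open>(v, u)\<close>.
\<close>

definition path_graph :: "nat \<Rightarrow> nat pair_pre_digraph" where
  "path_graph n =
    \<lparr> pverts = {..<n}, parcs = {(i, j). i < n \<and> j < n \<and> (j = Suc i \<or> i = Suc j)} \<rparr>"

definition cartesian_product ::
  "'a pair_pre_digraph \<Rightarrow> 'b pair_pre_digraph \<Rightarrow> ('a \<times> 'b) pair_pre_digraph"
  (infixl \<open>\<box>\<close> 70) where
  "G \<box> H =
    \<lparr> pverts = pverts G \<times> pverts H,
      parcs = {((g\<^sub>1, h\<^sub>1), (g\<^sub>2, h\<^sub>2)).
        g\<^sub>1 \<in> pverts G \<and> g\<^sub>2 \<in> pverts G \<and> h\<^sub>1 \<in> pverts H \<and> h\<^sub>2 \<in> pverts H \<and>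
        (h\<^sub>1 = h\<^sub>2 \<and> (g\<^sub>1, g\<^sub>2) \<in> parcs G \<or> g\<^sub>1 = g\<^sub>2 \<and> (h\<^sub>1, h\<^sub>2) \<in> parcs H)} \<rparr>"

text \<open>The library's shortest-path cost with unit weights; it is \<open>\<infinity>\<close> for unreachable pairs.\<close>

definition graph_dist :: "'a pair_pre_digraph \<Rightarrow> 'a \<Rightarrow> 'a \<Rightarrow> ereal" where
  "graph_dist G u v = wf_digraph.\<mu> (with_proj G) (\<lambda>_. 1) u v"

definition error_correcting :: "'a pair_pre_digraph \<Rightarrow> nat \<Rightarrow> 'a set \<Rightarrow> bool" where
  "error_correcting G t D \<longleftrightarrow>
    (\<forall>x\<in>D. \<forall>y\<in>D. x \<noteq> y \<longrightarrow> graph_dist G x y \<ge> ereal (real (2 * t + 1)))"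

definition covers_within :: "'a pair_pre_digraph \<Rightarrow> 'a set \<Rightarrow> nat \<Rightarrow> bool" where
  "covers_within G D r \<longleftrightarrow> (\<forall>v\<in>pverts G. \<exists>c\<in>D. graph_dist G v c \<le> ereal (real r))"

text \<open>
  Stated as a relation, so that a code without covering radius (such as the empty code in a
  nonempty graph) has none, rather than an unspecified value.
\<close>

definition has_covering_radius :: "'a pair_pre_digraph \<Rightarrow> 'a set \<Rightarrow> nat \<Rightarrow> bool" where
  "has_covering_radius G D r \<longleftrightarrow>
    covers_within G D r \<and> (\<forall>s. covers_within G D s \<longrightarrow> r \<le> s)"

definition quasi_perfect_code :: "'a pair_pre_digraph \<Rightarrow> nat \<Rightarrow> 'a set \<Rightarrow> bool" where
  "quasi_perfect_code G t D \<longleftrightarrow>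
    D \<subseteq> pverts G \<and> error_correcting G t D \<and> has_covering_radius G D (t + 1)"

lemma pair_graph_path_graph: "pair_graph (path_graph n)"
proof
  have "parcs (path_graph n) \<subseteq> {..<n} \<times> {..<n}" by (auto simp: path_graph_def)
  then show "finite (parcs (path_graph n))" by (rule finite_subset) simp
qed (auto simp: path_graph_def symmetric_def sym_def)

lemma pair_graph_cartesian_product:
  assumes "pair_graph G" "pair_graph H"
  shows "pair_graph (G \<box> H)"
proof -
  interpret G: pair_graph G by fact
  interpret H: pair_graph H by fact
  show ?thesis
  proof
    have "parcs (G \<box> H) \<subseteq> (pverts G \<times> pverts H) \<times> (pverts G \<times> pverts H)"
      by (auto simp: cartesian_product_def)
    then show "finite (parcs (G \<box> H))" by (rule finite_subset) simp
  qed (auto simp: cartesian_product_def symmetric_def sym_def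
        dest: G.arcs_symmetric H.arcs_symmetric G.no_loops' H.no_loops')
qed

lemma strongly_connected_path_graph:
  assumes "n \<ge> 1"
  shows "strongly_connected (path_graph n)"
proof -
  interpret pair_graph "path_graph n" by (rule pair_graph_path_graph)
  have from0: "0 \<rightarrow>\<^sup>*\<^bsub>path_graph n\<^esub> i" if "i < n" for i
    using that
  proof (induction i)
    case 0
    then have "0 \<in> pverts (path_graph n)" by (simp add: path_graph_def)
    then show ?case by (rule reachable_refl)
  next
    case (Suc i)
    then have "(i, Suc i) \<in> parcs (path_graph n)" by (auto simp: path_graph_def)
    with Suc show ?case by (auto intro: reachable_adj_trans)
  qed
  have "i \<rightarrow>\<^sup>*\<^bsub>path_graph n\<^esub> j" if "i < n" "j < n" for i j
    using from0[OF that(1)] from0[OF that(2)]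
    by (meson reachable_trans symmetric_reachable sym_arcs)
  then show ?thesis using assms by (auto simp: strongly_connected_def path_graph_def lessThan_empty_iff)
qed

lemma strongly_connected_cartesian_product:
  assumes "pair_graph G" "pair_graph H" "strongly_connected G" "strongly_connected H"
  shows "strongly_connected (G \<box> H)"
proof -
  interpret G: pair_graph G by fact
  interpret H: pair_graph H by fact
  interpret P: pair_graph "G \<box> H" by (rule pair_graph_cartesian_product) fact+
  have verts: "pverts (G \<box> H) = pverts G \<times> pverts H" by (simp add: cartesian_product_def)
  have 1: "(g, h) \<rightarrow>\<^sup>*\<^bsub>G \<box> H\<^esub> (g', h)" if "g \<rightarrow>\<^sup>*\<^bsub>G\<^esub> g'" "h \<in> pverts H" for g g' h
    using that(1)
  proof (induction rule: G.reachable_induct)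
    case base
    then have "(g, h) \<in> pverts (G \<box> H)" using that(2) by (simp add: verts)
    then show ?case by (rule P.reachable_refl)
  next
    case (step x y)
    then have "((x, h), (y, h)) \<in> parcs (G \<box> H)"
      using that(2) by (auto simp: cartesian_product_def dest: G.wellformed')
    with step show ?case by (auto intro: P.reachable_adj_trans)
  qed
  have 2: "(g, h) \<rightarrow>\<^sup>*\<^bsub>G \<box> H\<^esub> (g, h')" if "h \<rightarrow>\<^sup>*\<^bsub>H\<^esub> h'" "g \<in> pverts G" for g h h'
    using that(1)
  proof (induction rule: H.reachable_induct)
    case base
    then have "(g, h) \<in> pverts (G \<box> H)" using that(2) by (simp add: verts)
    then show ?case by (rule P.reachable_refl)
  next
    case (step x y)
    then have "((g, x), (g, y)) \<in> parcs (G \<box> H)"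
      using that(2) by (auto simp: cartesian_product_def dest: H.wellformed')
    with step show ?case by (auto intro: P.reachable_adj_trans)
  qed
  have "(g, h) \<rightarrow>\<^sup>*\<^bsub>G \<box> H\<^esub> (g', h')"
    if "g \<in> pverts G" "g' \<in> pverts G" "h \<in> pverts H" "h' \<in> pverts H" for g g' h h'
    using that assms(3,4) 1[of g g' h] 2[of h h' g']
    by (auto simp: strongly_connected_def intro: P.reachable_trans)
  then show ?thesis
    using assms(3,4) by (auto simp: strongly_connected_def verts)
qed

lemma graph_dist_eq:
  assumes "pair_graph G"
  shows "graph_dist G u v =
    (INF p\<in>{p. pre_digraph.awalk (with_proj G) u p v}. ereal (real (length p)))"
proof -
  interpret pair_graph G by fact
  have "awalk_cost (\<lambda>_. 1) p = real (length p)" for p :: "('a \<times> 'a) list"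
    by (induction p) auto
  then show ?thesis unfolding graph_dist_def \<mu>_def by simp
qed

end

theory Submission
  imports Defs
begin

text \<open>
  In \<open>P\<^sub>n \<box> P\<^sub>n \<box> P\<^sub>m\<close> with \<open>m \<in> {3, 4}\<close> take two opposite corners as the code. They are at
  distance \<open>2n + m - 3 \<ge> 2n - 1\<close>. Every vertex lies on a geodesic between them, so its two
  distances sum to \<open>2n + m - 3 \<le> 2n + 1\<close> and one of them is at most \<open>n\<close>. The vertex
  \<open>(0, n - 1, 1)\<close> is at distance at least \<open>n\<close> from both.
\<close>

section \<open>Walks and shortest-path distance\<close>

abbreviation walk :: "'a pair_pre_digraph \<Rightarrow> 'a \<Rightarrow> ('a \<times> 'a) list \<Rightarrow> 'a \<Rightarrow> bool" where
  "walk G \<equiv> pre_digraph.awalk (with_proj G)"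

lemma walk_Nil_iff:
  assumes "pair_graph G"
  shows "walk G u [] v \<longleftrightarrow> u = v \<and> u \<in> pverts G"
proof -
  interpret pair_graph G by fact
  show ?thesis by (auto simp: awalk_Nil_iff)
qed

lemma walk_Cons_iff:
  assumes "pair_graph G"
  shows "walk G u (e # p) w \<longleftrightarrow> e \<in> parcs G \<and> u = fst e \<and> walk G (snd e) p w"
proof -
  interpret pair_graph G by fact
  show ?thesis by (auto simp: awalk_Cons_iff)
qed

lemma walk_append:
  assumes "pair_graph G" "walk G u p v" "walk G v q w"
  shows "walk G u (p @ q) w"
proof -
  interpret pair_graph G by fact
  show ?thesis using assms(2,3) by (rule awalk_appendI)
qed

lemma walk_endpoints_in_pverts:
  assumes "pair_graph G" "walk G u p v"
  shows "u \<in> pverts G" "v \<in> pverts G"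
proof -
  interpret pair_graph G by fact
  show "u \<in> pverts G" "v \<in> pverts G" using assms(2) by auto
qed

lemma graph_dist_le_length:
  assumes "pair_graph G" "walk G u p v"
  shows "graph_dist G u v \<le> ereal (real (length p))"
  unfolding graph_dist_eq[OF assms(1)] using assms(2) by (intro INF_lower) simp

lemma le_graph_distI:
  assumes "pair_graph G" "\<And>p. walk G u p v \<Longrightarrow> d \<le> ereal (real (length p))"
  shows "d \<le> graph_dist G u v"
  unfolding graph_dist_eq[OF assms(1)] using assms(2) by (intro INF_greatest) simp

text \<open>Lengths are natural numbers, so the infimum defining the distance is attained as soon as
  some walk exists. Finite distances can then be handled through an actual walk.\<close>

lemma shortest_walk:
  assumes "pair_graph G" "walk G u p v"
  obtains q where "walk G u q v" "graph_dist G u v = ereal (real (length q))"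
proof -
  obtain q where q: "walk G u q v" "\<And>p. walk G u p v \<Longrightarrow> length q \<le> length p"
    using ex_has_least_nat[of "\<lambda>p. walk G u p v" p length] assms(2) by auto
  have "graph_dist G u v = ereal (real (length q))"
    using q by (intro antisym graph_dist_le_length le_graph_distI assms(1)) auto
  with q(1) show ?thesis by (rule that)
qed

lemma graph_dist_unreachable:
  assumes "pair_graph G" "\<And>p. \<not> walk G u p v"
  shows "graph_dist G u v = \<infinity>"
  using le_graph_distI[OF assms(1), of u v \<infinity>] assms(2) by simp

section \<open>Distance in a Cartesian product\<close>

lemma pverts_cartesian_product: "pverts (G \<box> H) = pverts G \<times> pverts H"
  by (simp add: cartesian_product_def)

lemma walk_cartesian_product_fst:
  assumes "pair_graph G" "pair_graph H" "h \<in> pverts H" "walk G g p g'"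
  shows "\<exists>r. walk (G \<box> H) (g, h) r (g', h) \<and> length r = length p"
  using assms(4)
proof (induction p arbitrary: g)
  case Nil
  then show ?case
    using assms by (auto simp: walk_Nil_iff pair_graph_cartesian_product pverts_cartesian_product)
next
  case (Cons e p)
  interpret G: pair_graph G by fact
  from Cons obtain r where r: "walk (G \<box> H) (snd e, h) r (g', h)" "length r = length p"
    using assms by (auto simp: walk_Cons_iff)
  have "((g, h), (snd e, h)) \<in> parcs (G \<box> H)"
    using Cons.prems assms G.wellformed[of e] by (auto simp: walk_Cons_iff cartesian_product_def)
  with r show ?case
    using assms
    by (intro exI[of _ "((g, h), (snd e, h)) # r"])
      (simp add: walk_Cons_iff pair_graph_cartesian_product)
qed

lemma walk_cartesian_product_snd:
  assumes "pair_graph G" "pair_graph H" "g \<in> pverts G" "walk H h p h'"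
  shows "\<exists>r. walk (G \<box> H) (g, h) r (g, h') \<and> length r = length p"
  using assms(4)
proof (induction p arbitrary: h)
  case Nil
  then show ?case
    using assms by (auto simp: walk_Nil_iff pair_graph_cartesian_product pverts_cartesian_product)
next
  case (Cons e p)
  interpret H: pair_graph H by fact
  from Cons obtain r where r: "walk (G \<box> H) (g, snd e) r (g, h')" "length r = length p"
    using assms by (auto simp: walk_Cons_iff)
  have "((g, h), (g, snd e)) \<in> parcs (G \<box> H)"
    using Cons.prems assms H.wellformed[of e] by (auto simp: walk_Cons_iff cartesian_product_def)
  with r show ?case
    using assms
    by (intro exI[of _ "((g, h), (g, snd e)) # r"])
      (simp add: walk_Cons_iff pair_graph_cartesian_product)
qed

text \<open>Each arc of the product moves along an arc of one factor and fixes the other coordinate.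
  Charging it to that factor splits the walk with no loss of length, which yields the lower bound on
  product distances.\<close>

lemma walk_cartesian_product_project:
  assumes "pair_graph G" "pair_graph H" "walk (G \<box> H) (g, h) r (g', h')"
  shows "\<exists>p q. walk G g p g' \<and> walk H h q h' \<and> length p + length q = length r"
  using assms(3)
proof (induction r arbitrary: g h)
  case Nil
  then have "walk G g [] g' \<and> walk H h [] h'"
    using assms by (auto simp: walk_Nil_iff pair_graph_cartesian_product pverts_cartesian_product)
  then show ?case by fastforce
next
  case (Cons e r)
  obtain g\<^sub>1 h\<^sub>1 where e: "e = ((g, h), (g\<^sub>1, h\<^sub>1))" "e \<in> parcs (G \<box> H)"
    and "walk (G \<box> H) (g\<^sub>1, h\<^sub>1) r (g', h')"
    using Cons.prems assms by (cases e) (auto simp: walk_Cons_iff pair_graph_cartesian_product)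
  with Cons.IH obtain p q where pq: "walk G g\<^sub>1 p g'" "walk H h\<^sub>1 q h'"
    "length p + length q = length r" by blast
  from e consider "h = h\<^sub>1" "(g, g\<^sub>1) \<in> parcs G" | "g = g\<^sub>1" "(h, h\<^sub>1) \<in> parcs H"
    by (auto simp: cartesian_product_def)
  then show ?case
  proof cases
    case 1
    with pq assms show ?thesis
      by (intro exI[of _ "(g, g\<^sub>1) # p"] exI[of _ q]) (simp add: walk_Cons_iff)
  next
    case 2
    with pq assms show ?thesis
      by (intro exI[of _ p] exI[of _ "(h, h\<^sub>1) # q"]) (simp add: walk_Cons_iff)
  qed
qed

lemma graph_dist_cartesian_product:
  assumes "pair_graph G" "pair_graph H"
  shows "graph_dist (G \<box> H) (g, h) (g', h') = graph_dist G g g' + graph_dist H h h'"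
proof (rule antisym)
  note GH = pair_graph_cartesian_product[OF assms]
  show "graph_dist (G \<box> H) (g, h) (g', h') \<le> graph_dist G g g' + graph_dist H h h'"
  proof (cases "(\<exists>p. walk G g p g') \<and> (\<exists>q. walk H h q h')")
    case True
    then obtain p q where
      p: "walk G g p g'" "graph_dist G g g' = ereal (real (length p))" and
      q: "walk H h q h'" "graph_dist H h h' = ereal (real (length q))"
      by (meson shortest_walk assms)
    obtain r s where r: "walk (G \<box> H) (g, h) r (g', h)" "length r = length p"
      and s: "walk (G \<box> H) (g', h) s (g', h')" "length s = length q"
      using walk_cartesian_product_fst[OF assms walk_endpoints_in_pverts(1)[OF assms(2) q(1)] p(1)]
        walk_cartesian_product_snd[OF assms walk_endpoints_in_pverts(2)[OF assms(1) p(1)] q(1)]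
      by blast
    show ?thesis
      using graph_dist_le_length[OF GH walk_append[OF GH r(1) s(1)]] p q r s by simp
  next
    case False
    \<comment> \<open>An infimum over no walks is \<infinity>, so the right-hand side is \<infinity>
      and the bound is trivial.\<close>
    then have "graph_dist G g g' = \<infinity> \<or> graph_dist H h h' = \<infinity>"
      using assms by (meson graph_dist_unreachable)
    then show ?thesis by auto
  qed
  show "graph_dist G g g' + graph_dist H h h' \<le> graph_dist (G \<box> H) (g, h) (g', h')"
  proof (rule le_graph_distI[OF GH])
    fix r assume "walk (G \<box> H) (g, h) r (g', h')"
    then obtain p q where pq: "walk G g p g'" "walk H h q h'" "length p + length q = length r"
      using walk_cartesian_product_project[OF assms] by blast
    have "graph_dist G g g' + graph_dist H h h' \<le> ereal (real (length p)) + ereal (real (length q))"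
      by (intro add_mono graph_dist_le_length assms pq)
    also have "\<dots> = ereal (real (length r))" using pq(3) by simp
    finally show "graph_dist G g g' + graph_dist H h h' \<le> ereal (real (length r))" .
  qed
qed

section \<open>Distance in a path and in a three-dimensional grid\<close>

text \<open>Every arc changes the position by exactly one, so the triangle inequality bounds the
  total displacement by the number of arcs.\<close>

lemma walk_path_graph_length:
  assumes "walk (path_graph n) i p j"
  shows "\<bar>real i - real j\<bar> \<le> real (length p)"
  using assms
proof (induction p arbitrary: i)
  case Nil
  then show ?case by (simp add: walk_Nil_iff pair_graph_path_graph)
next
  case (Cons e p)
  then have "\<bar>real (snd e) - real j\<bar> \<le> real (length p)" "(i, snd e) \<in> parcs (path_graph n)"
    by (auto simp: walk_Cons_iff pair_graph_path_graph)
  then show ?case by (auto simp: path_graph_def)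
qed

lemma walk_path_graph_up:
  assumes "i + k < n"
  shows "\<exists>p. walk (path_graph n) i p (i + k) \<and> length p = k"
  using assms
proof (induction k arbitrary: i)
  case 0
  then have "walk (path_graph n) i [] i"
    by (simp add: walk_Nil_iff pair_graph_path_graph) (simp add: path_graph_def)
  then show ?case by simp
next
  case (Suc k)
  then obtain p where "walk (path_graph n) (Suc i) p (Suc i + k)" "length p = k"
    using Suc.IH[of "Suc i"] by auto
  moreover have "(i, Suc i) \<in> parcs (path_graph n)"
    using Suc.prems by (auto simp: path_graph_def)
  ultimately show ?case
    by (intro exI[of _ "(i, Suc i) # p"]) (simp add: walk_Cons_iff pair_graph_path_graph)
qed

lemma walk_path_graph_down:
  assumes "i + k < n"
  shows "\<exists>p. walk (path_graph n) (i + k) p i \<and> length p = k"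
  using assms
proof (induction k)
  case 0
  then have "walk (path_graph n) i [] i"
    by (simp add: walk_Nil_iff pair_graph_path_graph) (simp add: path_graph_def)
  then show ?case by simp
next
  case (Suc k)
  then obtain p where "walk (path_graph n) (i + k) p i" "length p = k" by auto
  moreover have "(Suc (i + k), i + k) \<in> parcs (path_graph n)"
    using Suc.prems by (auto simp: path_graph_def)
  ultimately show ?case
    by (intro exI[of _ "(Suc (i + k), i + k) # p"]) (simp add: walk_Cons_iff pair_graph_path_graph)
qed

lemma graph_dist_path_graph:
  assumes "i < n" "j < n"
  shows "graph_dist (path_graph n) i j = ereal \<bar>real i - real j\<bar>"
proof (rule antisym)
  \<comment> \<open>The monotone walk, upwards or downwards, attains the lower bound.\<close>
  obtain p where p: "walk (path_graph n) i p j" "real (length p) = \<bar>real i - real j\<bar>"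
  proof (cases "i \<le> j")
    case True
    then show ?thesis using walk_path_graph_up[of i "j - i" n] assms that by auto
  next
    case False
    then show ?thesis using walk_path_graph_down[of j "i - j" n] assms that by auto
  qed
  then show "graph_dist (path_graph n) i j \<le> ereal \<bar>real i - real j\<bar>"
    using graph_dist_le_length[OF pair_graph_path_graph p(1)] by simp
  show "ereal \<bar>real i - real j\<bar> \<le> graph_dist (path_graph n) i j"
    by (rule le_graph_distI[OF pair_graph_path_graph]) (simp add: walk_path_graph_length)
qed

text \<open>Applying the product formula twice gives the l1 metric. The nested pairs reflect that
  \<open>\<box>\<close> associates to the left.\<close>

lemma graph_dist_grid3:
  assumes "x < a" "x' < a" "y < b" "y' < b" "z < c" "z' < c"
  shows "graph_dist (path_graph a \<box> path_graph b \<box> path_graph c) ((x, y), z) ((x', y'), z') =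
    ereal (\<bar>real x - real x'\<bar> + \<bar>real y - real y'\<bar> + \<bar>real z - real z'\<bar>)"
  using assms
  by (simp add: graph_dist_cartesian_product pair_graph_cartesian_product pair_graph_path_graph
      graph_dist_path_graph)

section \<open>The code of two opposite corners\<close>

text \<open>The bound \<open>3 \<le> m\<close> serves the separation of the codewords and the lower
  bound on the covering radius; \<open>m \<le> 4\<close> serves the covering.\<close>

lemma opposite_corners_quasi_perfect:
  fixes n m :: nat
  assumes "n \<ge> 2" "3 \<le> m" "m \<le> 4"
  shows "quasi_perfect_code (path_graph n \<box> path_graph n \<box> path_graph m) (n - 1)
    {((0, 0), 0), ((n - 1, n - 1), m - 1)}" (is "quasi_perfect_code ?G _ ?D")
proof -
  have verts: "pverts ?G = ({..<n} \<times> {..<n}) \<times> {..<m}"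
    by (simp add: cartesian_product_def path_graph_def)
  have "?D \<subseteq> pverts ?G" using assms by (auto simp: verts)
  \<comment> \<open>The corners are \<open>2 * (n - 1) + (m - 1)\<close> apart, and
    \<open>m - 1 \<ge> 2\<close> exceeds the required \<open>2 * (n - 1) + 1\<close>.\<close>
  moreover have "error_correcting ?G (n - 1) ?D"
    using assms by (auto simp: error_correcting_def graph_dist_grid3)
  moreover have "covers_within ?G ?D n"
    unfolding covers_within_def
  proof
    fix v assume "v \<in> pverts ?G"
    then obtain x y z where v: "v = ((x, y), z)" "x < n" "y < n" "z < m" by (auto simp: verts)
    then have "real x \<le> real n - 1" "real y \<le> real n - 1" "real z \<le> real m - 1" by linarith+
    \<comment> \<open>The sum \<open>x + y + z\<close> is the distance to the origin. If it is at
      least \<open>n + 1\<close>, the other corner is at distance at most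
      \<open>(2 * n + 1) - (n + 1) = n\<close>.\<close>
    with v assms show "\<exists>c\<in>?D. graph_dist ?G v c \<le> ereal (real n)"
      by (cases "x + y + z \<le> n") (auto simp: graph_dist_grid3)
  qed
  moreover have "n \<le> s" if "covers_within ?G ?D s" for s
  proof -
    \<comment> \<open>This vertex is at distance \<open>(n - 1) + 1 = n\<close> from the origin and
      \<open>(n - 1) + (m - 2) \<ge> n\<close> from the other corner.\<close>
    have "((0, n - 1), 1) \<in> pverts ?G" using assms by (auto simp: verts)
    with that obtain c where "c \<in> ?D" "graph_dist ?G ((0, n - 1), 1) c \<le> ereal (real s)"
      unfolding covers_within_def by blast
    with assms show ?thesis by (auto simp: graph_dist_grid3)
  qed
  moreover have "n - 1 + 1 = n" using assms(1) by simp
  ultimately show ?thesis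
    unfolding quasi_perfect_code_def has_covering_radius_def by metis
qed

theorem theorem13:
  fixes n :: nat
  assumes "n \<ge> 2"
  shows "(\<exists>D. quasi_perfect_code (path_graph n \<box> path_graph n \<box> path_graph 3) (n - 1) D) \<and>
         (\<exists>D. quasi_perfect_code (path_graph n \<box> path_graph n \<box> path_graph 4) (n - 1) D)"
  using opposite_corners_quasi_perfect[OF assms, of 3] opposite_corners_quasi_perfect[OF assms, of 4]
  by auto

end
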